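(* Let $d\mu$ be a nontrivial normalized $k\times k$ matrix-valued measure on $\partial\mathbb{D}$ with Verblunsky coefficients $\{\alpha_n\}_{n=0}^\infty$, CMV basis $\{\chi_\ell\}_{\ell=0}^\infty$ and alternate CMV basis $\{x_\ell\}_{\ell=0}^\infty$. Let $\mathcal{L}$ and $\mathcal{M}$ be the semi-infinite block matrices with $k\times k$ blocks $$\mathcal{L}_{j\ell}=\langle\!\langle\chi_j,zx_\ell\rangle\!\rangle_L,\qquad \mathcal{M}_{j\ell}=\langle\!\langle x_j,\chi_\ell\rangle\!\rangle_L\qquad(j,\ell\ge0).$$ Then $$\mathcal{M}=\mathbf{1}\oplus\Theta_1(\alpha_1)\oplus\Theta_3(\alpha_3)\oplus\cdots,\qquad \mathcal{L}=\Theta_0(\alpha_0)\oplus\Theta_2(\alpha_2)\oplus\Theta_4(\alpha_4)\oplus\cdots,$$ where $\mathbf{1}$ is a single $k\times k$ identity block and $\Theta_j(\alpha)$ denotes the $2k\times2k$ matrix $$\Theta(\alpha)=\begin{pmatrix}\alpha^\dagger&\rho^L\\ \rho^R&-\alpha\end{pmatrix},\qquad \rho^L=(1-\alpha^\dagger\alpha)^{1/2},\quad \rho^R=(1-\alpha\alpha^\dagger)^{1/2},$$ acting on the copy of $\mathbb{C}^{2k}$ corresponding to the block indices $j,j+1$.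
   Context: Let $\mathbb{D}=\{z\in\mathbb{C}:|z|<1\}$, $k\ge1$, and let ${}^\dagger$ denote the adjoint of a $k\times k$ matrix. A normalized $k\times k$ matrix-valued measure on $\partial\mathbb{D}$ is $d\mu(\theta)=A(\theta)\,d\mu_t(\theta)$, where $d\mu_t$ is a positive scalar measure on $\partial\mathbb{D}$, $A(\theta)\ge0$ and $\operatorname{Tr}A(\theta)=1$ for $\mu_t$-a.e. $\theta$, and $\int A\,d\mu_t=\mathbf{1}$. It is nontrivial if for every $\varphi\in\mathbb{C}^k\setminus\{0\}$ the scalar measure $\langle\varphi,A(\theta)\varphi\rangle\,d\mu_t(\theta)$ is not supported on a finite set. For $k\times k$ matrix-valued functions put $$\langle\!\langle f,g\rangle\!\rangle_R=\int f^\dagger(\theta)\,d\mu(\theta)\,g(\theta),\qquad \langle\!\langle f,g\rangle\!\rangle_L=\int g(\theta)\,d\mu(\theta)\,f^\dagger(\theta).$$ The normalized orthogonal polynomials $\varphi_n^R,\varphi_n^L$ ($n\ge0$) are polynomials in $z$ of degree $n$ with $k\times k$ matrix coefficients and leading coefficients $\kappa_n^R,\kappa_n^L$, with $\langle\!\langle\varphi_n^R,\varphi_m^R\rangle\!\rangle_R=\delta_{nm}\mathbf{1}$, $\langle\!\langle\varphi_n^L,\varphi_m^L\rangle\!\rangle_L=\delta_{nm}\mathbf{1}$, normalized by $\varphi_0^L=\varphi_0^R=\mathbf{1}$, $\kappa_{n+1}^L(\kappa_n^L)^{-1}>0$, $(\kappa_n^R)^{-1}\kappa_{n+1}^R>0$.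 For a matrix polynomial $P_n$ of degree $n$, $P_n^*(z)=z^nP_n(1/\bar z)^\dagger$. The Verblunsky coefficients are the $k\times k$ matrices $\{\alpha_n\}_{n=0}^\infty$, $\|\alpha_n\|<1$, such that, with $\rho_n^L=(1-\alpha_n^\dagger\alpha_n)^{1/2}$ and $\rho_n^R=(1-\alpha_n\alpha_n^\dagger)^{1/2}$, $$z\varphi_n^L=\rho_n^L\varphi_{n+1}^L+\alpha_n^\dagger(\varphi_n^R)^*,\qquad z\varphi_n^R=\varphi_{n+1}^R\rho_n^R+(\varphi_n^L)^*\alpha_n^\dagger,$$ $$(\varphi_n^L)^*=(\varphi_{n+1}^L)^*\rho_n^L+z\varphi_n^R\alpha_n,\qquad (\varphi_n^R)^*=\rho_n^R(\varphi_{n+1}^R)^*+\alpha_nz\varphi_n^L.$$ The CMV basis and alternate CMV basis are $$\chi_{2m}=z^{-m}(\varphi_{2m}^R)^*,\quad \chi_{2m-1}=z^{-m+1}\varphi_{2m-1}^L,\quad x_{2m}=z^{-m}\varphi_{2m}^L,\quad x_{2m-1}=z^{-m}(\varphi_{2m-1}^R)^*;$$ both are orthonormal for $\langle\!\langle\cdot,\cdot\rangle\!\rangle_L$.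
   Formalization: With j as block row the identities fail for k≥2 (L_{01} equals ρ_0^R, not ρ_0^L); the formal theorem places the blocks L_{jℓ} and M_{jℓ} in block row ℓ and block column j (blocks not transposed), which amounts to swapping ρ^L and ρ^R in Θ. *)

theory Defs
  imports "HOL-Analysis.Analysis" "HOL-Computational_Algebra.Polynomial"
begin

section \<open>Complex matrices\<close>

type_synonym 'k cmat = "complex ^ 'k ^ 'k"

definition cadj :: "'k::finite cmat \<Rightarrow> 'k cmat"  (\<open>_\<^sup>\<dagger>\<close> [1000] 999)
  where "A\<^sup>\<dagger> = (\<chi> i j. cnj (A $ j $ i))"

definition cscale :: "complex \<Rightarrow> 'k::finite cmat \<Rightarrow> 'k cmat"  (infixr \<open>*\<^sub>C\<close> 75)
  where "c *\<^sub>C A = (\<chi> i j. c * A $ i $ j)"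

definition cinner :: "complex ^ 'k \<Rightarrow> complex ^ 'k::finite \<Rightarrow> complex"
  where "cinner v w = (\<Sum>i\<in>UNIV. cnj (v $ i) * w $ i)"

definition psd :: "'k::finite cmat \<Rightarrow> bool"
  where "psd A \<longleftrightarrow> A\<^sup>\<dagger> = A \<and> (\<forall>v. 0 \<le> Re (cinner v (A *v v)))"

definition posdef :: "'k::finite cmat \<Rightarrow> bool"
  where "posdef A \<longleftrightarrow> A\<^sup>\<dagger> = A \<and> (\<forall>v. v \<noteq> 0 \<longrightarrow> 0 < Re (cinner v (A *v v)))"

definition msqrt :: "'k::finite cmat \<Rightarrow> 'k cmat"
  where "msqrt A = (THE B. psd B \<and> B ** B = A)"

definition rhoL :: "'k::finite cmat \<Rightarrow> 'k cmat"
  where "rhoL \<alpha> = msqrt (mat 1 - \<alpha>\<^sup>\<dagger> ** \<alpha>)"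

definition rhoR :: "'k::finite cmat \<Rightarrow> 'k cmat"
  where "rhoR \<alpha> = msqrt (mat 1 - \<alpha> ** \<alpha>\<^sup>\<dagger>)"

section \<open>Matrix-valued measures on the unit circle\<close>

text \<open>The measure \<open>A d\<mu>\<close> is given by the scalar measure \<open>\<mu>\<close> and the density \<open>A\<close>. A function of
  the angle \<open>\<theta>\<close> is written as a function of the point \<open>z\<close> of the unit circle.\<close>

definition normalized_matrix_measure :: "complex measure \<Rightarrow> (complex \<Rightarrow> 'k::finite cmat) \<Rightarrow> bool"
  where "normalized_matrix_measure \<mu> A \<longleftrightarrow>
    sets \<mu> = sets (restrict_space borel (sphere 0 1)) \<and>
    (AE z in \<mu>. psd (A z) \<and> trace (A z) = 1) \<and>
    integrable \<mu> A \<and> (LINT z|\<mu>. A z) = mat 1"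

definition nontrivial_matrix_measure :: "complex measure \<Rightarrow> (complex \<Rightarrow> 'k::finite cmat) \<Rightarrow> bool"
  where "nontrivial_matrix_measure \<mu> A \<longleftrightarrow>
    (\<forall>v. v \<noteq> 0 \<longrightarrow>
      \<not> (\<exists>F. finite F \<and>
            emeasure (density \<mu> (\<lambda>z. ennreal (Re (cinner v (A z *v v))))) (space \<mu> - F) = 0))"

definition innerR ::
    "complex measure \<Rightarrow> (complex \<Rightarrow> 'k::finite cmat) \<Rightarrow> (complex \<Rightarrow> 'k cmat) \<Rightarrow> (complex \<Rightarrow> 'k cmat) \<Rightarrow> 'k cmat"
  where "innerR \<mu> A f g = (LINT z|\<mu>. (f z)\<^sup>\<dagger> ** A z ** g z)"

definition innerL ::
    "complex measure \<Rightarrow> (complex \<Rightarrow> 'k::finite cmat) \<Rightarrow> (complex \<Rightarrow> 'k cmat) \<Rightarrow> (complex \<Rightarrow> 'k cmat) \<Rightarrow> 'k cmat"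
  where "innerL \<mu> A f g = (LINT z|\<mu>. g z ** A z ** (f z)\<^sup>\<dagger>)"

section \<open>Orthogonal polynomials and Verblunsky coefficients\<close>

text \<open>The type \<open>poly\<close> only carries coefficients and degree here: \<open>*\<close> on \<open>'k cmat\<close> is the
  entrywise product, so neither evaluation by the function \<open>poly\<close> nor multiplication of
  polynomials is used.\<close>

definition meval :: "'k::finite cmat poly \<Rightarrow> complex \<Rightarrow> 'k cmat"
  where "meval P z = (\<Sum>i\<le>degree P. z ^ i *\<^sub>C coeff P i)"

text \<open>The value at \<open>z = 0\<close> is not the one of the reversed polynomial; only \<open>z \<noteq> 0\<close> is used.\<close>

definition mstar :: "nat \<Rightarrow> 'k::finite cmat poly \<Rightarrow> complex \<Rightarrow> 'k cmat"
  where "mstar n P z = z ^ n *\<^sub>C (meval P (1 / cnj z))\<^sup>\<dagger>"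

definition normalized_ops ::
    "complex measure \<Rightarrow> (complex \<Rightarrow> 'k::finite cmat) \<Rightarrow>
     (nat \<Rightarrow> 'k cmat poly) \<Rightarrow> (nat \<Rightarrow> 'k cmat poly) \<Rightarrow> bool"
  where "normalized_ops \<mu> A \<phi>L \<phi>R \<longleftrightarrow>
    (\<forall>n. degree (\<phi>L n) = n \<and> degree (\<phi>R n) = n) \<and>
    (\<forall>n m. innerR \<mu> A (meval (\<phi>R n)) (meval (\<phi>R m)) = (if n = m then mat 1 else 0)) \<and>
    (\<forall>n m. innerL \<mu> A (meval (\<phi>L n)) (meval (\<phi>L m)) = (if n = m then mat 1 else 0)) \<and>
    \<phi>L 0 = [:mat 1:] \<and> \<phi>R 0 = [:mat 1:] \<and>
    (\<forall>n. posdef (lead_coeff (\<phi>L (Suc n)) ** matrix_inv (lead_coeff (\<phi>L n)))) \<and>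
    (\<forall>n. posdef (matrix_inv (lead_coeff (\<phi>R n)) ** lead_coeff (\<phi>R (Suc n))))"

definition verblunsky_coeffs ::
    "(nat \<Rightarrow> 'k::finite cmat poly) \<Rightarrow> (nat \<Rightarrow> 'k cmat poly) \<Rightarrow> (nat \<Rightarrow> 'k cmat) \<Rightarrow> bool"
  where "verblunsky_coeffs \<phi>L \<phi>R \<alpha> \<longleftrightarrow>
    (\<forall>n. onorm ((*v) (\<alpha> n)) < 1) \<and>
    (\<forall>n z. z \<noteq> 0 \<longrightarrow>
       z *\<^sub>C meval (\<phi>L n) z =
         rhoL (\<alpha> n) ** meval (\<phi>L (Suc n)) z + (\<alpha> n)\<^sup>\<dagger> ** mstar n (\<phi>R n) z \<and>
       z *\<^sub>C meval (\<phi>R n) z =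
         meval (\<phi>R (Suc n)) z ** rhoR (\<alpha> n) + mstar n (\<phi>L n) z ** (\<alpha> n)\<^sup>\<dagger> \<and>
       mstar n (\<phi>L n) z =
         mstar (Suc n) (\<phi>L (Suc n)) z ** rhoL (\<alpha> n) + z *\<^sub>C (meval (\<phi>R n) z ** \<alpha> n) \<and>
       mstar n (\<phi>R n) z =
         rhoR (\<alpha> n) ** mstar (Suc n) (\<phi>R (Suc n)) z + \<alpha> n ** (z *\<^sub>C meval (\<phi>L n) z))"

section \<open>CMV bases and the block matrices\<close>

text \<open>In both odd cases \<open>l = 2 * m - 1\<close> with \<open>m = (l + 1) div 2\<close>.\<close>

definition cmv_chi ::
    "(nat \<Rightarrow> 'k::finite cmat poly) \<Rightarrow> (nat \<Rightarrow> 'k cmat poly) \<Rightarrow> nat \<Rightarrow> complex \<Rightarrow> 'k cmat"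
  where "cmv_chi \<phi>L \<phi>R l z =
    (if even l then z powi (- int (l div 2)) *\<^sub>C mstar l (\<phi>R l) z
     else z powi (- int ((l + 1) div 2) + 1) *\<^sub>C meval (\<phi>L l) z)"

definition cmv_x ::
    "(nat \<Rightarrow> 'k::finite cmat poly) \<Rightarrow> (nat \<Rightarrow> 'k cmat poly) \<Rightarrow> nat \<Rightarrow> complex \<Rightarrow> 'k cmat"
  where "cmv_x \<phi>L \<phi>R l z =
    (if even l then z powi (- int (l div 2)) *\<^sub>C meval (\<phi>L l) z
     else z powi (- int ((l + 1) div 2)) *\<^sub>C mstar l (\<phi>R l) z)"

type_synonym 'k blockmat = "nat \<Rightarrow> nat \<Rightarrow> 'k cmat"

definition cmv_L ::
    "complex measure \<Rightarrow> (complex \<Rightarrow> 'k::finite cmat) \<Rightarrow>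
     (nat \<Rightarrow> 'k cmat poly) \<Rightarrow> (nat \<Rightarrow> 'k cmat poly) \<Rightarrow> 'k blockmat"
  where "cmv_L \<mu> A \<phi>L \<phi>R j l =
    innerL \<mu> A (cmv_chi \<phi>L \<phi>R j) (\<lambda>z. z *\<^sub>C cmv_x \<phi>L \<phi>R l z)"

definition cmv_M ::
    "complex measure \<Rightarrow> (complex \<Rightarrow> 'k::finite cmat) \<Rightarrow>
     (nat \<Rightarrow> 'k cmat poly) \<Rightarrow> (nat \<Rightarrow> 'k cmat poly) \<Rightarrow> 'k blockmat"
  where "cmv_M \<mu> A \<phi>L \<phi>R j l = innerL \<mu> A (cmv_x \<phi>L \<phi>R j) (cmv_chi \<phi>L \<phi>R l)"

text \<open>For the left inner product a basis expansion reads \<open>f = (\<Sum>j. innerL \<mu> A (\<chi> j) f ** \<chi> j)\<close>: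
  coefficients stand on the left, i.e. they form row vectors, on which matrices act from the
  right. The block with indices \<open>j l\<close> (coefficient of the \<open>j\<close>-th vector of the one basis in
  the image of the \<open>l\<close>-th vector of the other) therefore belongs in block row \<open>l\<close> and block
  column \<open>j\<close>. The blocks themselves are not transposed. For matrices of size at least 2 the
  placement matters, as \<open>rhoL \<alpha>\<close> and \<open>rhoR \<alpha>\<close> differ in general: with \<open>j\<close> as the row index,
  \<open>cmv_L\<close> has \<open>rhoR (\<alpha> 0)\<close>, not \<open>rhoL (\<alpha> 0)\<close>, in row 0, column 1.\<close>

definition row_action :: "'k::finite blockmat \<Rightarrow> 'k blockmat"
  where "row_action B = (\<lambda>r c. B c r)"

definition Theta :: "'k::finite cmat \<Rightarrow> 'k blockmat"
  where "Theta \<alpha> r c = [[\<alpha>\<^sup>\<dagger>, rhoL \<alpha>], [rhoR \<alpha>, - \<alpha>]] ! r ! c"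

text \<open>The direct sum of \<open>2 \<times> 2\<close> block matrices \<open>B 0\<close>, \<open>B 1\<close>, \<dots>; the summand \<open>B m\<close> occupies
  the block indices \<open>2 * m\<close> and \<open>2 * m + 1\<close>.\<close>

definition block_dsum :: "(nat \<Rightarrow> 'k::finite blockmat) \<Rightarrow> 'k blockmat"
  where "block_dsum B r c = (if r div 2 = c div 2 then B (r div 2) (r mod 2) (c mod 2) else 0)"

definition one_dsum :: "'k::finite blockmat \<Rightarrow> 'k blockmat"
  where "one_dsum B r c =
    (if r = 0 \<and> c = 0 then mat 1 else if r = 0 \<or> c = 0 then 0 else B (r - 1) (c - 1))"

end

theory Submission
  imports Defs
begin

text \<open>
  Entries of \<open>\<M>\<close> and \<open>\<L>\<close> are the coefficients of \<open>\<chi>\<^sub>l\<close> in the basis \<open>x\<close> and of \<open>z x\<^sub>l\<close> in the basis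
  \<open>\<chi>\<close>. Fix \<open>n\<close> and look at \<open>(\<phi>\<^sub>n\<^sup>R)\<^sup>*\<close>, \<open>\<phi>\<^bsub>n+1\<^esub>\<^sup>L\<close>, \<open>z \<phi>\<^sub>n\<^sup>L\<close> and \<open>(\<phi>\<^bsub>n+1\<^esub>\<^sup>R)\<^sup>*\<close>. Up to a common power
  of \<open>z\<close> these are, for odd \<open>n\<close>, the functions \<open>x\<^sub>n, x\<^bsub>n+1\<^esub>, \<chi>\<^sub>n, \<chi>\<^bsub>n+1\<^esub>\<close>, and for even \<open>n\<close> the
  functions \<open>\<chi>\<^sub>n, \<chi>\<^bsub>n+1\<^esub>, z x\<^sub>n, z x\<^bsub>n+1\<^esub>\<close>. In both cases the last two are obtained from the first two
  by \<open>\<Theta>(\<alpha>\<^sub>n)\<close>: the first row is the Szego recursion for \<open>z \<phi>\<^sub>n\<^sup>L\<close>, the second row is the recursion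
  for \<open>(\<phi>\<^sub>n\<^sup>R)\<^sup>*\<close> solved for \<open>(\<phi>\<^bsub>n+1\<^esub>\<^sup>R)\<^sup>*\<close> (lemma \<open>inverse_recR\<close>). Together with the orthonormality
  of both bases this gives every block (lemma \<open>Theta_row\<close>).

  Orthonormality is a statement about exponents. Left orthogonal polynomials are orthogonal to all
  lower monomials, reversed right ones to \<open>z, \<dots>, z\<^sup>n\<close>, so every basis function is orthogonal to
  the window of exponents that contains its predecessors (\<open>orthonormal_by_windows\<close>).

  Solving the recursion for \<open>(\<phi>\<^bsub>n+1\<^esub>\<^sup>R)\<^sup>*\<close> requires that \<open>\<rho>\<^sup>R\<close> is invertible,
  that \<open>(\<rho>\<^sup>R)\<^sup>2 = 1 - \<alpha> \<alpha>\<^sup>\<dagger>\<close>, and that \<open>\<alpha> \<rho>\<^sup>L = \<rho>\<^sup>R \<alpha>\<close>. All this is read off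
  from the orthogonal polynomials: by the recursions \<open>\<rho>\<^sup>L\<close> and \<open>\<rho>\<^sup>R\<close> are ratios of consecutive
  leading coefficients, hence positive definite by normalization; comparing norms gives their squares;
  and the intertwining relation holds because a Sylvester equation with positive definite
  coefficients has only the zero solution (\<open>posdef_sylvester\<close>).
\<close>

section \<open>Algebra of complex matrices\<close>

lemma cadj_nth [simp]: "A\<^sup>\<dagger> $ i $ j = cnj (A $ j $ i)"
  by (simp add: cadj_def)

lemma cscale_nth [simp]: "(c *\<^sub>C A) $ i $ j = c * A $ i $ j"
  by (simp add: cscale_def)

lemma cadj_cadj [simp]: "(A\<^sup>\<dagger>)\<^sup>\<dagger> = A"
  by (simp add: vec_eq_iff)

lemma cadj_mult: "(A ** B)\<^sup>\<dagger> = B\<^sup>\<dagger> ** A\<^sup>\<dagger>"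
  by (simp add: vec_eq_iff matrix_matrix_mult_def mult.commute)

lemma cadj_add: "(A + B)\<^sup>\<dagger> = A\<^sup>\<dagger> + B\<^sup>\<dagger>"
  by (simp add: vec_eq_iff)

lemma cadj_zero [simp]: "0\<^sup>\<dagger> = 0"
  by (simp add: vec_eq_iff)

lemma cadj_mat_1 [simp]: "(mat 1)\<^sup>\<dagger> = mat 1"
  by (simp add: vec_eq_iff mat_def)

lemma cadj_cscale: "(c *\<^sub>C A)\<^sup>\<dagger> = cnj c *\<^sub>C A\<^sup>\<dagger>"
  by (simp add: vec_eq_iff)

lemma cadj_sum: "(\<Sum>i\<in>S. f i)\<^sup>\<dagger> = (\<Sum>i\<in>S. (f i)\<^sup>\<dagger>)"
  by (induction S rule: infinite_finite_induct) (auto simp: cadj_add)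

lemma cscale_mult_left: "(c *\<^sub>C A) ** B = c *\<^sub>C (A ** B)"
  by (simp add: vec_eq_iff matrix_matrix_mult_def sum_distrib_left mult_ac)

lemma cscale_mult_right: "A ** (c *\<^sub>C B) = c *\<^sub>C (A ** B)"
  by (simp add: vec_eq_iff matrix_matrix_mult_def sum_distrib_left mult_ac)

lemma cscale_cscale [simp]: "c *\<^sub>C d *\<^sub>C A = (c * d) *\<^sub>C A"
  by (simp add: vec_eq_iff mult.assoc)

lemma cscale_one [simp]: "1 *\<^sub>C A = A"
  by (simp add: vec_eq_iff)

lemma cscale_zero [simp]: "c *\<^sub>C 0 = 0"
  by (simp add: vec_eq_iff)

lemma cscale_add: "c *\<^sub>C (A + B) = c *\<^sub>C A + c *\<^sub>C B"
  by (simp add: vec_eq_iff distrib_left)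

lemma cscale_sum: "c *\<^sub>C (\<Sum>i\<in>S. f i) = (\<Sum>i\<in>S. c *\<^sub>C f i)"
  by (induction S rule: infinite_finite_induct) (auto simp: cscale_add)

lemma matrix_add_rdistrib: "(A + B) ** C = A ** C + B ** (C :: 'k::finite cmat)"
  by (simp add: vec_eq_iff matrix_matrix_mult_def distrib_right sum.distrib)

lemma matrix_diff_ldistrib: "A ** (B - C) = A ** B - A ** (C :: 'k::finite cmat)"
  by (simp add: vec_eq_iff matrix_matrix_mult_def right_diff_distrib sum_subtractf)

lemma matrix_diff_rdistrib: "(A - B) ** C = A ** C - B ** (C :: 'k::finite cmat)"
  by (simp add: vec_eq_iff matrix_matrix_mult_def left_diff_distrib sum_subtractf)

lemma matrix_minus_left: "(- A) ** B = - (A ** (B :: 'k::finite cmat))"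
  by (simp add: vec_eq_iff matrix_matrix_mult_def sum_negf)

lemma norm_cscale: "norm (c *\<^sub>C A) = norm c * norm A"
proof -
  have "norm ((c *\<^sub>C A) $ i) = norm c * norm (A $ i)" for i
    by (simp add: norm_vec_def norm_mult L2_set_right_distrib)
  then show ?thesis
    unfolding norm_vec_def[of "c *\<^sub>C A"] norm_vec_def[of A]
    by (simp add: L2_set_right_distrib)
qed

lemma bounded_linear_sandwich: "bounded_linear (\<lambda>X. C ** X ** (D :: 'k::finite cmat))"
  unfolding linear_conv_bounded_linear[symmetric]
proof (rule linearI)
  show "C ** (X + Y) ** D = C ** X ** D + C ** Y ** D" for X Y
    by (simp add: matrix_add_ldistrib matrix_add_rdistrib)
  show "C ** (r *\<^sub>R X) ** D = r *\<^sub>R (C ** X ** D)" for r X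
    by (simp add: vec_eq_iff matrix_matrix_mult_def scaleR_sum_right flip: scaleR_sum_right)
qed

lemma bounded_linear_cadj: "bounded_linear (cadj :: 'k::finite cmat \<Rightarrow> _)"
  unfolding linear_conv_bounded_linear[symmetric]
  by (rule linearI) (simp_all add: vec_eq_iff)

lemma measurable_cscale:
  assumes "f \<in> borel_measurable M" "g \<in> borel_measurable M"
  shows "(\<lambda>x. f x *\<^sub>C (g x :: 'k::finite cmat)) \<in> borel_measurable M"
  using assms unfolding cscale_def
  by (rule borel_measurable_continuous_Pair) (intro continuous_intros)

section \<open>Positive definite matrices\<close>

lemma cinner_sym: "cinner w v = cnj (cinner v w)"
  by (simp add: cinner_def mult.commute)

lemma posdef_adj: "posdef P \<Longrightarrow> P\<^sup>\<dagger> = P"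
  by (simp add: posdef_def)

lemma posdef_invertible:
  assumes "posdef P" shows "invertible P"
  unfolding invertible_left_inverse matrix_left_invertible_ker
proof (intro allI impI)
  fix v assume "P *v v = 0"
  then have "Re (cinner v (P *v v)) = 0" by (simp add: cinner_def)
  with assms show "v = 0" by (force simp: posdef_def)
qed

text \<open>With \<open>w = Q v\<close> the form \<open>\<langle>v, Q v\<rangle>\<close> is the conjugate of \<open>\<langle>w, P w\<rangle>\<close>.\<close>

lemma posdef_right_inverse:
  assumes P: "posdef P" and PQ: "P ** Q = mat 1"
  shows "posdef Q"
  unfolding posdef_def
proof (intro conjI allI impI)
  have "Q\<^sup>\<dagger> ** P = mat 1"
    using arg_cong[OF PQ, of cadj] by (simp add: cadj_mult posdef_adj[OF P])
  then show "Q\<^sup>\<dagger> = Q"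
    by (metis PQ matrix_mul_assoc matrix_mul_lid matrix_mul_rid)
next
  fix v :: "complex ^ 'a" assume "v \<noteq> 0"
  define w where "w = Q *v v"
  have v: "P *v w = v" by (simp add: w_def matrix_vector_mul_assoc PQ)
  with \<open>v \<noteq> 0\<close> have "w \<noteq> 0" by auto
  with P have "0 < Re (cinner w (P *v w))" by (simp add: posdef_def)
  also have "\<dots> = Re (cinner v (Q *v v))" unfolding v by (subst cinner_sym) (simp add: w_def)
  finally show "0 < Re (cinner v (Q *v v))" .
qed

lemma cinner_column:
  fixes X :: "'k::finite cmat"
  shows
  "(\<Sum>i\<in>UNIV. cinner (column i X) (P *v column i X)) = trace (X\<^sup>\<dagger> ** P ** X)"
  unfolding matrix_mul_assoc[symmetric]
  by (simp add: trace_def cinner_def matrix_matrix_mult_def matrix_vector_mult_def column_def)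

lemma trace_posdef_nonneg:
  fixes X :: "'k::finite cmat"
  assumes "posdef P"
  shows "0 \<le> Re (trace (X\<^sup>\<dagger> ** P ** X))"
    and "Re (trace (X\<^sup>\<dagger> ** P ** X)) = 0 \<Longrightarrow> X = 0"
proof -
  have *: "0 \<le> Re (cinner v (P *v v))" for v
    using assms by (cases "v = 0") (auto simp: posdef_def cinner_def less_imp_le)
  then show "0 \<le> Re (trace (X\<^sup>\<dagger> ** P ** X))"
    unfolding cinner_column[symmetric] Re_sum by (intro sum_nonneg) auto
  assume "Re (trace (X\<^sup>\<dagger> ** P ** X)) = 0"
  then have "\<forall>i. Re (cinner (column i X) (P *v column i X)) = 0"
    unfolding cinner_column[symmetric] Re_sum using * by (subst (asm) sum_nonneg_eq_0_iff) auto
  then have "\<forall>i. column i X = 0"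
    using assms by (force simp: posdef_def)
  then show "X = 0"
    by (simp add: column_def vec_eq_iff)
qed

text \<open>Multiplying by \<open>X\<^sup>\<dagger>\<close> and taking the trace turns the equation into
  \<open>tr (X\<^sup>\<dagger> P X) + tr (X Q X\<^sup>\<dagger>) = 0\<close>. Both terms are nonnegative, so the first one vanishes, which
  for positive definite \<open>P\<close> forces every column of \<open>X\<close> to be zero.\<close>

lemma posdef_sylvester:
  fixes X :: "'k::finite cmat"
  assumes P: "posdef P" and Q: "posdef Q" and eq: "P ** X + X ** Q = 0"
  shows "X = 0"
proof -
  have "trace (X\<^sup>\<dagger> ** (X ** Q)) = trace ((X\<^sup>\<dagger>)\<^sup>\<dagger> ** Q ** X\<^sup>\<dagger>)"
    by (subst trace_mul_sym) (simp add: matrix_mul_assoc)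
  moreover have "trace (X\<^sup>\<dagger> ** P ** X) + trace (X\<^sup>\<dagger> ** (X ** Q)) = 0"
    using arg_cong[OF eq, of "\<lambda>Y. trace (X\<^sup>\<dagger> ** Y)"]
    by (simp add: matrix_add_ldistrib trace_add matrix_mul_assoc)
      (simp add: trace_def)
  ultimately have "Re (trace (X\<^sup>\<dagger> ** P ** X)) + Re (trace ((X\<^sup>\<dagger>)\<^sup>\<dagger> ** Q ** X\<^sup>\<dagger>)) = 0"
    by (metis plus_complex.sel(1) zero_complex.sel(1))
  with trace_posdef_nonneg[OF P, of X] trace_posdef_nonneg(1)[OF Q, of "X\<^sup>\<dagger>"]
  show "X = 0" by linarith
qed

text \<open>The difference \<open>X = \<alpha> P - Q \<alpha>\<close> solves the Sylvester equation
  \<open>Q X + X P = \<alpha> P\<^sup>2 - Q\<^sup>2 \<alpha> = 0\<close>, hence vanishes by \<open>posdef_sylvester\<close>.\<close>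

lemma defect_intertwining:
  assumes P: "posdef P" "P ** P = mat 1 - \<alpha>\<^sup>\<dagger> ** \<alpha>"
    and Q: "posdef Q" "Q ** Q = mat 1 - \<alpha> ** \<alpha>\<^sup>\<dagger>"
  shows "\<alpha> ** P = Q ** \<alpha>"
proof -
  have "Q ** (\<alpha> ** P - Q ** \<alpha>) + (\<alpha> ** P - Q ** \<alpha>) ** P = \<alpha> ** (P ** P) - (Q ** Q) ** \<alpha>"
    by (simp add: matrix_diff_ldistrib matrix_diff_rdistrib matrix_mul_assoc)
  also have "\<dots> = 0"
    unfolding P(2) Q(2) by (simp add: matrix_diff_ldistrib matrix_diff_rdistrib matrix_mul_assoc)
  finally have "\<alpha> ** P - Q ** \<alpha> = 0"
    by (rule posdef_sylvester[OF Q(1) P(1)])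
  then show ?thesis by simp
qed

section \<open>Laurent polynomials on the circle and their inner products\<close>

text \<open>Laurent polynomials with matrix coefficients and exponents in \<open>I\<close>, known only through their
  values on the unit circle. The inductive form makes statements that are linear in the function
  provable by adding one monomial at a time, without reindexing sums. Every rule contains an
  equality on the circle because values elsewhere are irrelevant to integrals over the circle,
  while conjugation agrees with inversion only there.\<close>

inductive laurent :: "int set \<Rightarrow> (complex \<Rightarrow> 'k::finite cmat) \<Rightarrow> bool" for I where
  zero: "(\<And>z. norm z = 1 \<Longrightarrow> f z = 0) \<Longrightarrow> laurent I f"
| add: "laurent I f \<Longrightarrow> k \<in> I \<Longrightarrow> (\<And>z. norm z = 1 \<Longrightarrow> g z = f z + z powi k *\<^sub>C C)
    \<Longrightarrow> laurent I g"

lemma laurent_cong: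
  assumes "laurent I f" and "\<And>z. norm z = 1 \<Longrightarrow> g z = f z"
  shows "laurent I g"
  using assms(1)
proof cases
  case zero
  with assms(2) show ?thesis by (intro laurent.zero) simp
next
  case (add h k C)
  show ?thesis
    by (rule laurent.add[OF add(1,2)]) (simp add: assms(2) add(3))
qed

lemma laurent_mono: "laurent I f \<Longrightarrow> I \<subseteq> J \<Longrightarrow> laurent J f"
proof (induction rule: laurent.induct)
  case (zero f)
  then show ?case by (intro laurent.zero)
next
  case (add f k g C)
  from add.IH[OF add.prems] add.hyps(2) add.prems add.hyps(3) show ?case
    by (intro laurent.add[of J f k g C]) auto
qed

lemma laurent_monomial: "k \<in> I \<Longrightarrow> laurent I (\<lambda>z. z powi k *\<^sub>C C)"
  by (rule laurent.add[of I "\<lambda>_. 0" k]) (auto intro: laurent.zero)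

lemma laurent_add: "laurent I f \<Longrightarrow> laurent I g \<Longrightarrow> laurent I (\<lambda>z. f z + g z)"
proof (induction rule: laurent.induct)
  case (zero f)
  from zero.prems show ?case by (rule laurent_cong) (simp add: zero.hyps)
next
  case (add f k f' C)
  show ?case
    by (rule laurent.add[OF add.IH[OF add.prems] add.hyps(2), of _ C]) (simp add: add.hyps(3) add_ac)
qed

lemma laurent_sum: "(\<And>i. i \<in> S \<Longrightarrow> laurent I (f i)) \<Longrightarrow> laurent I (\<lambda>z. \<Sum>i\<in>S. f i z)"
  by (induction S rule: infinite_finite_induct) (auto intro: laurent.zero laurent_add)

lemma laurent_shift:
  "laurent I f \<Longrightarrow> (\<And>i. i \<in> I \<Longrightarrow> i + k \<in> J) \<Longrightarrow> laurent J (\<lambda>z. z powi k *\<^sub>C f z)"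
proof (induction rule: laurent.induct)
  case (zero f)
  then show ?case by (intro laurent.zero) simp
next
  case (add f i g C)
  have "z powi k *\<^sub>C g z = z powi k *\<^sub>C f z + z powi (i + k) *\<^sub>C C" if "norm z = 1" for z
  proof -
    from that have "z \<noteq> 0" by auto
    with that show ?thesis
      by (simp add: add.hyps(3) cscale_add power_int_add mult.commute)
  qed
  with add show ?case by (intro laurent.add[OF add.IH, of "i + k"]) auto
qed

lemma cnj_circle: "norm z = 1 \<Longrightarrow> cnj z = inverse z"
  by (metis complex_cnj_inverse complex_cnj_cnj complex_norm_square inverse_unique mult.commute
      of_real_1 one_power2)

lemma cnj_powi_circle: "norm z = 1 \<Longrightarrow> cnj z powi k = z powi (- k)"
  by (simp add: cnj_circle power_int_minus power_int_inverse)

lemma powi_mult_circle: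
  fixes z :: complex
  shows "norm z = 1 \<Longrightarrow> z powi a * z powi b = z powi (a + b)"
  by (subst power_int_add) auto

lemma laurent_mult: "laurent I f \<Longrightarrow> laurent I (\<lambda>z. C ** f z)"
proof (induction rule: laurent.induct)
  case (zero f)
  then show ?case by (intro laurent.zero) simp
next
  case (add f i g D)
  then show ?case
    by (intro laurent.add[OF add.IH, of i _ "C ** D"])
      (auto simp: matrix_add_ldistrib cscale_mult_right)
qed

locale matrix_measure =
  fixes \<mu> :: "complex measure" and A :: "complex \<Rightarrow> 'k::finite cmat"
  assumes normalized: "normalized_matrix_measure \<mu> A"
begin

abbreviation ip where "ip \<equiv> innerL \<mu> A"

lemma space_eq: "space \<mu> = sphere 0 1"
proof -
  have "sets \<mu> = sets (restrict_space borel (sphere 0 1))"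
    using normalized by (simp add: normalized_matrix_measure_def)
  from sets_eq_imp_space_eq[OF this] show ?thesis
    by (simp add: space_restrict_space)
qed

lemma ip_cong:
  assumes "\<And>z. norm z = 1 \<Longrightarrow> f z = f' z" "\<And>z. norm z = 1 \<Longrightarrow> g z = g' z"
  shows "ip f g = ip f' g'"
  unfolding innerL_def using assms
  by (intro Bochner_Integration.integral_cong) (auto simp: space_eq)

lemma measurable_monomial: "(\<lambda>z. z powi k) \<in> borel_measurable \<mu>"
proof -
  have "sets \<mu> = sets (restrict_space borel (sphere 0 1))"
    using normalized by (simp add: normalized_matrix_measure_def)
  moreover have "(\<lambda>z::complex. z powi k) \<in> borel_measurable (restrict_space borel (sphere 0 1))"
    by (intro borel_measurable_continuous_on_restrict continuous_intros) auto
  ultimately show ?thesis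
    using measurable_cong_sets by blast
qed

text \<open>Only integrability of \<open>A\<close> itself is given; on the circle a power of \<open>z\<close> has modulus 1.\<close>

lemma integrable_moment: "integrable \<mu> (\<lambda>z. z powi k *\<^sub>C A z)"
proof -
  have A: "integrable \<mu> A"
    using normalized by (simp add: normalized_matrix_measure_def)
  show ?thesis
  proof (rule Bochner_Integration.integrable_bound[OF A])
    show "(\<lambda>z. z powi k *\<^sub>C A z) \<in> borel_measurable \<mu>"
      by (intro measurable_cscale measurable_monomial borel_measurable_integrable A)
    show "AE z in \<mu>. norm (z powi k *\<^sub>C A z) \<le> norm (A z)"
      by (rule AE_I2) (simp add: space_eq norm_cscale norm_power_int)
  qed
qed

text \<open>By linearity in each argument it suffices to treat two monomials, whose product is
  \<open>C (z\<^bsup>k-j\<^esup> A(z)) D\<^sup>\<dagger>\<close>.\<close>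

lemma integrable_ip:
  assumes f: "laurent I f" and g: "laurent J g"
  shows "integrable \<mu> (\<lambda>z. g z ** A z ** (f z)\<^sup>\<dagger>)"
  using g
proof (induction rule: laurent.induct)
  case (zero g)
  have "integrable \<mu> (\<lambda>z. 0 :: 'k cmat)" by simp
  then show ?case
    by (rule Bochner_Integration.integrable_cong[THEN iffD1, rotated 2]) (auto simp: zero space_eq)
next
  case (add g k g' C)
  have "integrable \<mu> (\<lambda>z. (z powi k *\<^sub>C C) ** A z ** (f z)\<^sup>\<dagger>)"
    using f
  proof (induction rule: laurent.induct)
    case (zero f)
    have "integrable \<mu> (\<lambda>z. 0 :: 'k cmat)" by simp
    then show ?case
      by (rule Bochner_Integration.integrable_cong[THEN iffD1, rotated 2]) (auto simp: zero space_eq)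
  next
    case (add f j f' D)
    have "integrable \<mu> (\<lambda>z. C ** (z powi (k - j) *\<^sub>C A z) ** D\<^sup>\<dagger>)"
      by (rule integrable_bounded_linear[OF bounded_linear_sandwich integrable_moment])
    with add.IH have "integrable \<mu>
        (\<lambda>z. (z powi k *\<^sub>C C) ** A z ** (f z)\<^sup>\<dagger> + C ** (z powi (k - j) *\<^sub>C A z) ** D\<^sup>\<dagger>)"
      by (rule Bochner_Integration.integrable_add)
    then show ?case
    proof (rule Bochner_Integration.integrable_cong[THEN iffD1, rotated 2, OF _ refl])
      fix z assume "z \<in> space \<mu>"
      then have z: "norm z = 1" "z \<noteq> 0" by (auto simp: space_eq)
      show "(z powi k *\<^sub>C C) ** A z ** (f z)\<^sup>\<dagger> + C ** (z powi (k - j) *\<^sub>C A z) ** D\<^sup>\<dagger>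
          = (z powi k *\<^sub>C C) ** A z ** (f' z)\<^sup>\<dagger>"
        by (simp add: add.hyps(3) z cadj_add matrix_add_ldistrib cadj_cscale cnj_powi_circle
            cscale_mult_left cscale_mult_right powi_mult_circle)
    qed
  qed
  with add.IH have "integrable \<mu>
      (\<lambda>z. g z ** A z ** (f z)\<^sup>\<dagger> + (z powi k *\<^sub>C C) ** A z ** (f z)\<^sup>\<dagger>)"
    by (rule Bochner_Integration.integrable_add)
  then show ?case
    by (rule Bochner_Integration.integrable_cong[THEN iffD1, rotated 2])
      (auto simp: add.hyps(3) space_eq matrix_add_rdistrib)
qed

lemma ip_add:
  assumes "laurent I f" "laurent J g" "laurent K h"
  shows "ip f (\<lambda>z. g z + h z) = ip f g + ip f h"
  unfolding innerL_def matrix_add_rdistrib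
  by (rule Bochner_Integration.integral_add)
    (rule integrable_ip[OF assms(1,2)], rule integrable_ip[OF assms(1,3)])

lemma ip_mult:
  assumes "laurent I f" "laurent J g"
  shows "ip f (\<lambda>z. C ** g z) = C ** ip f g"
  using integral_bounded_linear[OF bounded_linear_sandwich[of C "mat 1"] integrable_ip[OF assms]]
  by (simp add: innerL_def matrix_mul_assoc)

lemma ip_comb:
  assumes "laurent I f" "laurent J g" "laurent K h"
    and "\<And>z. norm z = 1 \<Longrightarrow> u z = C ** g z + D ** h z"
  shows "ip f u = C ** ip f g + D ** ip f h"
proof -
  have "ip f u = ip f (\<lambda>z. C ** g z + D ** h z)" by (rule ip_cong) (auto simp: assms)
  then show ?thesis
    using assms by (simp add: ip_add[of I f J _ K] ip_mult[of I _ J] ip_mult[of I _ K] laurent_mult)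
qed

lemma ip_adj:
  assumes f: "laurent I f" and g: "laurent J g"
  shows "ip f g = (ip g f)\<^sup>\<dagger>"
proof -
  have "(ip g f)\<^sup>\<dagger> = (LINT z|\<mu>. (f z ** A z ** (g z)\<^sup>\<dagger>)\<^sup>\<dagger>)"
    unfolding innerL_def
    by (rule integral_bounded_linear[OF bounded_linear_cadj integrable_ip[OF g f], symmetric])
  also have "\<dots> = (LINT z|\<mu>. g z ** A z ** (f z)\<^sup>\<dagger>)"
  proof (rule integral_cong_AE)
    show "(\<lambda>z. (f z ** A z ** (g z)\<^sup>\<dagger>)\<^sup>\<dagger>) \<in> borel_measurable \<mu>"
      by (intro borel_measurable_integrable integrable_bounded_linear[OF bounded_linear_cadj]
          integrable_ip[OF g f])
    show "(\<lambda>z. g z ** A z ** (f z)\<^sup>\<dagger>) \<in> borel_measurable \<mu>"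
      by (intro borel_measurable_integrable integrable_ip[OF f g])
    have "AE z in \<mu>. psd (A z) \<and> trace (A z) = 1"
      using normalized by (simp add: normalized_matrix_measure_def)
    then show "AE z in \<mu>. (f z ** A z ** (g z)\<^sup>\<dagger>)\<^sup>\<dagger> = g z ** A z ** (f z)\<^sup>\<dagger>"
      by (rule AE_mp) (simp add: psd_def cadj_mult matrix_mul_assoc)
  qed
  finally show ?thesis by (simp add: innerL_def)
qed

lemma gram_comb:
  assumes g: "laurent I g" and h: "laurent J h"
    and u: "\<And>z. norm z = 1 \<Longrightarrow> u z = C ** g z + D ** h z"
    and on: "ip g g = mat 1" "ip h h = mat 1" "ip g h = 0"
  shows "ip u u = C ** C\<^sup>\<dagger> + D ** D\<^sup>\<dagger>"
proof -
  let ?K = "I \<union> J"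
  have "laurent ?K (\<lambda>z. C ** g z + D ** h z)"
    by (intro laurent_add laurent_mult laurent_mono[OF g] laurent_mono[OF h]) auto
  then have uK: "laurent ?K u" by (rule laurent_cong) (rule u)
  have hg: "ip h g = 0" using on(3) by (simp add: ip_adj[OF h g])
  have "ip u g = C\<^sup>\<dagger>"
    by (simp add: ip_adj[OF uK g] ip_comb[OF g g h u] on)
  moreover have "ip u h = D\<^sup>\<dagger>"
    by (simp add: ip_adj[OF uK h] ip_comb[OF h g h u] on hg)
  ultimately show ?thesis by (simp add: ip_comb[OF uK g h u])
qed

lemma ip_shift:
  "ip (\<lambda>z. z powi k *\<^sub>C f z) (\<lambda>z. z powi k *\<^sub>C g z) = ip f g"
  unfolding innerL_def
proof (rule Bochner_Integration.integral_cong[OF refl])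
  fix z assume "z \<in> space \<mu>"
  then have z: "norm z = 1" "z \<noteq> 0" by (auto simp: space_eq)
  then have "cnj z powi k * z powi k = 1"
    by (simp add: cnj_powi_circle powi_mult_circle)
  then show "(z powi k *\<^sub>C g z) ** A z ** (z powi k *\<^sub>C f z)\<^sup>\<dagger> = g z ** A z ** (f z)\<^sup>\<dagger>"
    by (simp add: cadj_cscale cscale_mult_left cscale_mult_right)
qed

text \<open>For a left inner product the coefficient matrices of the test function factor out, so
  orthogonality to all Laurent polynomials with exponents in \<open>I\<close> (\<open>perp_laurent\<close>) needs to be
  tested on the scalar monomials only.\<close>

definition perp :: "int set \<Rightarrow> (complex \<Rightarrow> 'k cmat) \<Rightarrow> bool"
  where "perp I f \<longleftrightarrow> (\<forall>i\<in>I. ip (\<lambda>z. z powi i *\<^sub>C mat 1) f = 0)"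

lemma perp_shift:
  assumes "perp I f" "\<And>j. j \<in> J \<Longrightarrow> j - k \<in> I"
  shows "perp J (\<lambda>z. z powi k *\<^sub>C f z)"
  unfolding perp_def
proof
  fix j assume "j \<in> J"
  have "ip (\<lambda>z. z powi j *\<^sub>C mat 1) (\<lambda>z. z powi k *\<^sub>C f z)
      = ip (\<lambda>z. z powi k *\<^sub>C z powi (j - k) *\<^sub>C mat 1) (\<lambda>z. z powi k *\<^sub>C f z)"
    by (rule ip_cong) (simp_all add: powi_mult_circle)
  also have "\<dots> = 0"
    unfolding ip_shift using assms \<open>j \<in> J\<close> by (simp add: perp_def)
  finally show "ip (\<lambda>z. z powi j *\<^sub>C mat 1) (\<lambda>z. z powi k *\<^sub>C f z) = 0" .
qed

lemma perp_laurent: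
  assumes g: "laurent I g" and f: "perp I f" "laurent J f"
  shows "ip f g = 0"
  using g
proof (induction rule: laurent.induct)
  case (zero g)
  then have "ip f g = ip f (\<lambda>_. 0)" by (intro ip_cong) auto
  then show ?case by (simp add: innerL_def)
next
  case (add g k g' C)
  have mono: "laurent I (\<lambda>z. z powi k *\<^sub>C mat 1)"
    by (rule laurent_monomial[OF add.hyps(2)])
  have mono': "laurent I (\<lambda>z. C ** (z powi k *\<^sub>C mat 1))"
    by (rule laurent_cong[OF laurent_monomial[OF add.hyps(2), of C]]) (simp add: cscale_mult_right)
  have "ip f g' = ip f (\<lambda>z. g z + C ** (z powi k *\<^sub>C mat 1))"
    by (rule ip_cong) (auto simp: add.hyps(3) cscale_mult_right)
  also have "\<dots> = ip f g + C ** ip f (\<lambda>z. z powi k *\<^sub>C mat 1)"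
    by (simp add: ip_add[OF f(2) add.hyps(1) mono'] ip_mult[OF f(2) mono])
  also have "\<dots> = 0"
    using add.IH f(1) add.hyps(2) by (simp add: ip_adj[OF f(2) mono] perp_def)
  finally show ?case .
qed

text \<open>The pattern of a Gram-Schmidt basis: \<open>W l\<close> is the window of exponents in which the
  \<open>l\<close>-th function lives, and each function is orthogonal to the windows of its predecessors.\<close>

lemma orthonormal_by_windows:
  fixes W :: "nat \<Rightarrow> int set"
  assumes f: "\<And>l. laurent (W l) (f l)"
    and perp: "\<And>j l. j < l \<Longrightarrow> perp (W j) (f l)"
    and norm: "\<And>l. ip (f l) (f l) = mat 1"
  shows "ip (f j) (f l) = (if j = l then mat 1 else 0)"
proof (cases j l rule: linorder_cases)
  case less
  then show ?thesis
    using perp_laurent[OF f perp f, of j l] by (simp add: ip_adj[OF f f, of j l])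
next
  case greater
  then show ?thesis
    using perp_laurent[OF f perp f, of l j] by simp
qed (simp add: norm)

text \<open>An orthonormal sequence whose \<open>n\<close>-th member has degree \<open>n\<close> with invertible leading coefficient
  \<open>\<kappa>\<^sub>n = C n n\<close> spans the same spaces as the monomials, hence is orthogonal to all lower monomials.
  For \<open>s = 1\<close> this means that \<open>\<langle>P\<^bsub>n+1\<^esub>, g\<rangle>\<close> only sees the coefficient of order \<open>n + 1\<close>
  of a polynomial \<open>g\<close> of degree \<open>n + 1\<close>. Taking \<open>g = P\<^bsub>n+1\<^esub>\<close>
  identifies \<open>\<langle>P\<^bsub>n+1\<^esub>, z\<^bsup>n+1\<^esup>\<rangle>\<close> as \<open>\<kappa>\<^bsub>n+1\<^esub>\<^bsup>-1\<^esup>\<close>, and \<open>g = z P\<^sub>n\<close> gives \<open>\<kappa>\<^sub>n \<kappa>\<^bsub>n+1\<^esub>\<^bsup>-1\<^esup>\<close>.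
  The sign \<open>s\<close> covers polynomials in \<open>z\<close> (\<open>s = 1\<close>) and in \<open>1/z\<close> (\<open>s = -1\<close>); the latter arise as
  adjoints of right orthogonal polynomials.\<close>

lemma triangular_orthogonality:
  fixes P :: "nat \<Rightarrow> complex \<Rightarrow> 'k cmat" and s :: int
  assumes P: "\<And>n z. norm z = 1 \<Longrightarrow> P n z = (\<Sum>i\<le>n. z powi (s * int i) *\<^sub>C C n i)"
    and C: "\<And>n. invertible (C n n)"
    and orth: "\<And>m n. ip (P m) (P n) = (if m = n then mat 1 else 0)"
  shows "perp {s * int j |j. j < n} (P n)"
    and "laurent {s * int j |j. j \<le> n} (P n)"
    and "ip (P (Suc n)) (\<lambda>z. z powi s *\<^sub>C P n z) ** C (Suc n) (Suc n) = C n n"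
proof -
  define e :: "nat \<Rightarrow> complex \<Rightarrow> 'k cmat" where "e j = (\<lambda>z. z powi (s * int j) *\<^sub>C mat 1)" for j
  have mono: "laurent UNIV (\<lambda>z. z powi k *\<^sub>C X)" for k and X :: "'k cmat"
    by (simp add: laurent_monomial)
  have e: "laurent UNIV (e j)" for j unfolding e_def by (rule mono)
  have ee: "laurent UNIV (\<lambda>z. X ** e j z)" for X j
    by (rule laurent_cong[OF mono[of "s * int j" X]]) (simp add: e_def cscale_mult_right)
  have lower: "laurent {s * int j |j. j < n} (\<lambda>z. \<Sum>i<n. z powi (s * int i) *\<^sub>C C' i)" for n C'
    by (intro laurent_sum laurent_monomial) auto
  have P': "P n z = (\<Sum>i<n. z powi (s * int i) *\<^sub>C C n i) + C n n ** e n z" if "norm z = 1" for n z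
    using that by (simp add: P lessThan_Suc_atMost[symmetric] e_def cscale_mult_right)
  show laur: "laurent {s * int j |j. j \<le> n} (P n)" for n
    by (rule laurent_cong[of _ "\<lambda>z. \<Sum>i\<le>n. z powi (s * int i) *\<^sub>C C n i"])
      (auto intro!: laurent_sum laurent_monomial simp: P)
  \<comment> \<open>a function orthogonal to all lower monomials only sees the top coefficient\<close>
  have split: "ip f g = X ** ip f (e n)"
    if f: "laurent UNIV f" "perp {s * int j |j. j < n} f"
      and g: "\<And>z. norm z = 1 \<Longrightarrow> g z = (\<Sum>i<n. z powi (s * int i) *\<^sub>C C' i) + X ** e n z"
    for f g X n C'
  proof -
    have "ip f g = ip f (\<lambda>z. (\<Sum>i<n. z powi (s * int i) *\<^sub>C C' i) + X ** e n z)"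
      by (rule ip_cong) (auto simp: g)
    also have "\<dots> = ip f (\<lambda>z. \<Sum>i<n. z powi (s * int i) *\<^sub>C C' i) + X ** ip f (e n)"
      by (simp add: ip_add[OF f(1) lower ee] ip_mult[OF f(1) e])
    also have "ip f (\<lambda>z. \<Sum>i<n. z powi (s * int i) *\<^sub>C C' i) = 0"
      by (rule perp_laurent[OF lower f(2,1)])
    finally show ?thesis by simp
  qed
  have laurU: "laurent UNIV (P n)" for n by (rule laurent_mono[OF laur]) simp
  have perp_e: "j < n \<Longrightarrow> ip (e j) (P n) = 0" for j n
  proof (induction j rule: less_induct)
    case (less j)
    have "perp {s * int i |i. i < j} (P n)"
      using less by (auto simp: perp_def e_def)
    from split[OF laurU this P'] less.prems have "C j j ** ip (P n) (e j) = 0"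
      by (simp add: orth split: if_splits)
    then have "ip (P n) (e j) = 0"
      using C[of j] by (metis invertible_def matrix_mul_assoc matrix_mul_lid times0_right)
    then show ?case by (simp add: ip_adj[OF e laurU])
  qed
  then show perp: "perp {s * int j |j. j < n} (P n)" for n
    by (auto simp: perp_def e_def)
  have "C (Suc n) (Suc n) ** ip (P (Suc n)) (e (Suc n)) = mat 1"
    using split[OF laurU perp P', of "Suc n"] by (simp add: orth)
  then have inv: "ip (P (Suc n)) (e (Suc n)) ** C (Suc n) (Suc n) = mat 1"
    by (simp add: matrix_left_right_inverse)
  have "ip (P (Suc n)) (\<lambda>z. z powi s *\<^sub>C P n z) = C n n ** ip (P (Suc n)) (e (Suc n))"
  proof (rule split[OF laurU perp])
    fix z :: complex assume z: "norm z = 1"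
    then have "z \<noteq> 0" by auto
    then have *: "z powi s * z powi (s * int i) = z powi (s * int (Suc i))" for i
      by (simp add: power_int_add distrib_left)
    \<comment> \<open>multiplication by \<open>z powi s\<close> moves every coefficient up by one index\<close>
    show "z powi s *\<^sub>C P n z = (\<Sum>i<Suc n. z powi (s * int i) *\<^sub>C (if i = 0 then 0 else C n (i - 1)))
        + C n n ** e (Suc n) z"
      unfolding sum.lessThan_Suc_shift P'[OF z]
      by (simp add: cscale_add cscale_sum * e_def cscale_mult_right del: of_nat_Suc)
  qed
  with inv show "ip (P (Suc n)) (\<lambda>z. z powi s *\<^sub>C P n z) ** C (Suc n) (Suc n) = C n n"
    by (simp add: matrix_mul_assoc[symmetric])
qed

end

section \<open>Orthogonal polynomials and the Szego recursion\<close>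

lemma matrix_inv_right: "invertible M \<Longrightarrow> M ** matrix_inv M = mat 1"
  and matrix_inv_left: "invertible M \<Longrightarrow> matrix_inv M ** M = mat 1"
  unfolding invertible_def matrix_inv_def by (metis (mono_tags, lifting) someI_ex)+

text \<open>\<open>matrix_inv M\<close> is unspecified for singular \<open>M\<close>, so positivity of one ratio alone says nothing
  about \<open>\<kappa>\<close>; invertibility has to be carried along from \<open>\<kappa> 0\<close>.\<close>

lemma lead_coeffs_invertible:
  fixes \<kappa> :: "nat \<Rightarrow> 'k::finite cmat"
  assumes "\<kappa> 0 = mat 1"
    and "(\<forall>n. posdef (\<kappa> (Suc n) ** matrix_inv (\<kappa> n))) \<or> (\<forall>n. posdef (matrix_inv (\<kappa> n) ** \<kappa> (Suc n)))"
  shows "invertible (\<kappa> n)"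
proof (induction n)
  case 0
  show ?case by (simp add: assms(1) invertible_def exI[of _ "mat 1"])
next
  case (Suc n)
  from assms(2) show ?case
  proof
    assume "\<forall>n. posdef (\<kappa> (Suc n) ** matrix_inv (\<kappa> n))"
    then have "invertible (\<kappa> (Suc n) ** matrix_inv (\<kappa> n) ** \<kappa> n)"
      using Suc by (simp add: invertible_mult posdef_invertible)
    then show ?thesis
      using Suc by (simp add: matrix_mul_assoc[symmetric] matrix_inv_left)
  next
    assume "\<forall>n. posdef (matrix_inv (\<kappa> n) ** \<kappa> (Suc n))"
    then have "invertible (\<kappa> n ** (matrix_inv (\<kappa> n) ** \<kappa> (Suc n)))"
      using Suc by (simp add: invertible_mult posdef_invertible)
    then show ?thesis
      using Suc by (simp add: matrix_mul_assoc matrix_inv_right)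
  qed
qed

locale szego = matrix_measure \<mu> A
  for \<mu> :: "complex measure" and A :: "complex \<Rightarrow> 'k::finite cmat" +
  fixes \<phi>L \<phi>R :: "nat \<Rightarrow> 'k cmat poly" and \<alpha> :: "nat \<Rightarrow> 'k cmat"
  assumes ops: "normalized_ops \<mu> A \<phi>L \<phi>R"
    and verblunsky: "verblunsky_coeffs \<phi>L \<phi>R \<alpha>"
begin

text \<open>\<open>adjR n\<close> is \<open>(\<phi>\<^sub>n\<^sup>R)\<^sup>\<dagger>\<close>. Adjoints turn the right inner product into the left one
  (\<open>adjR_orth\<close>), so that only the left one has to be studied; on the circle \<open>adjR n\<close> is a
  polynomial in \<open>1/z\<close>, and \<open>revR n\<close> is the reversed polynomial \<open>(\<phi>\<^sub>n\<^sup>R)\<^sup>*\<close>. The shift by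
  \<open>z\<close> in \<open>zpL\<close> is written \<open>z powi 1\<close> to match the general shift lemmas.\<close>

definition pL :: "nat \<Rightarrow> complex \<Rightarrow> 'k cmat" where "pL n = meval (\<phi>L n)"
definition adjR :: "nat \<Rightarrow> complex \<Rightarrow> 'k cmat" where "adjR n z = (meval (\<phi>R n) z)\<^sup>\<dagger>"
definition revR :: "nat \<Rightarrow> complex \<Rightarrow> 'k cmat" where "revR n z = z powi int n *\<^sub>C adjR n z"

definition zpL :: "nat \<Rightarrow> complex \<Rightarrow> 'k cmat" where "zpL n = (\<lambda>z. z powi 1 *\<^sub>C pL n z)"

lemma mstar_eq: "norm z = 1 \<Longrightarrow> mstar n (\<phi>R n) z = revR n z"
  by (simp add: mstar_def revR_def adjR_def cnj_circle divide_inverse)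

lemma degrees: "degree (\<phi>L n) = n" "degree (\<phi>R n) = n"
  using ops by (auto simp: normalized_ops_def)

lemma pL_expansion: "pL n z = (\<Sum>i\<le>n. z powi (1 * int i) *\<^sub>C coeff (\<phi>L n) i)"
  by (simp add: pL_def meval_def degrees)

lemma adjR_expansion:
  "norm z = 1 \<Longrightarrow> adjR n z = (\<Sum>i\<le>n. z powi (- 1 * int i) *\<^sub>C (coeff (\<phi>R n) i)\<^sup>\<dagger>)"
  by (simp add: adjR_def meval_def degrees cadj_sum cadj_cscale cnj_powi_circle
      flip: power_int_of_nat)

lemma pL_orth: "ip (pL m) (pL n) = (if m = n then mat 1 else 0)"
  using ops by (auto simp: normalized_ops_def pL_def)

lemma adjR_orth: "ip (adjR m) (adjR n) = (if m = n then mat 1 else 0)"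
proof -
  have "innerR \<mu> A (meval (\<phi>R n)) (meval (\<phi>R m)) = (if n = m then mat 1 else 0)" for m n
    using ops unfolding normalized_ops_def by blast
  moreover have "ip (adjR m) (adjR n) = innerR \<mu> A (meval (\<phi>R n)) (meval (\<phi>R m))"
    by (simp add: innerL_def innerR_def adjR_def)
  ultimately show ?thesis by simp
qed

lemma posdef_ratioL: "posdef (coeff (\<phi>L (Suc n)) (Suc n) ** matrix_inv (coeff (\<phi>L n) n))"
proof -
  have "posdef (lead_coeff (\<phi>L (Suc n)) ** matrix_inv (lead_coeff (\<phi>L n)))"
    using ops unfolding normalized_ops_def by blast
  then show ?thesis by (simp only: degrees)
qed

lemma posdef_ratioR: "posdef (matrix_inv (coeff (\<phi>R n) n) ** coeff (\<phi>R (Suc n)) (Suc n))"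
proof -
  have "posdef (matrix_inv (lead_coeff (\<phi>R n)) ** lead_coeff (\<phi>R (Suc n)))"
    using ops unfolding normalized_ops_def by blast
  then show ?thesis by (simp only: degrees)
qed

lemma ops_0: "\<phi>L 0 = [:mat 1:]" "\<phi>R 0 = [:mat 1:]"
  using ops by (auto simp: normalized_ops_def)

lemma leadL: "invertible (coeff (\<phi>L n) n)"
  using posdef_ratioL by (intro lead_coeffs_invertible) (auto simp: ops_0)

lemma leadR: "invertible (coeff (\<phi>R n) n)"
  using posdef_ratioR by (intro lead_coeffs_invertible) (auto simp: ops_0)

lemma leadR': "invertible ((coeff (\<phi>R n) n)\<^sup>\<dagger>)"
  using leadR[of n] unfolding invertible_def by (metis cadj_mult cadj_mat_1)

lemmas triL = triangular_orthogonality[of pL 1 "\<lambda>n. coeff (\<phi>L n)",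
    OF pL_expansion leadL pL_orth]
lemmas triR = triangular_orthogonality[of adjR "- 1" "\<lambda>n i. (coeff (\<phi>R n) i)\<^sup>\<dagger>",
    OF adjR_expansion leadR' adjR_orth]

lemma pL_laurent: "laurent {0..int n} (pL n)"
  by (rule laurent_mono[OF triL(2)]) auto

lemma pL_perp: "perp {0..<int n} (pL n)"
proof -
  have "{0..<int n} = {1 * int j |j. j < n}" by (auto dest!: zero_le_imp_eq_int)
  with triL(1) show ?thesis by simp
qed

lemma revR_laurent: "laurent {0..int n} (revR n)"
  unfolding revR_def by (rule laurent_shift[OF triR(2)]) auto

lemma revR_perp: "perp {1..int n} (revR n)"
  unfolding revR_def
proof (rule perp_shift[OF triR(1)])
  fix j assume "j \<in> {1..int n}"
  then show "j - int n \<in> {- 1 * int i |i. i < n}"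
    by (intro CollectI exI[of _ "n - nat j"]) auto
qed

lemma revR_norm: "ip (revR n) (revR n) = mat 1"
  unfolding revR_def ip_shift by (simp add: adjR_orth)

lemma zpL_laurent: "laurent {1..int n + 1} (zpL n)"
  unfolding zpL_def by (rule laurent_shift[OF pL_laurent]) auto

lemma recL: "norm z = 1 \<Longrightarrow>
    zpL n z = rhoL (\<alpha> n) ** pL (Suc n) z + (\<alpha> n)\<^sup>\<dagger> ** revR n z"
  using verblunsky mstar_eq[of z n] unfolding verblunsky_coeffs_def zpL_def pL_def
  by (metis norm_zero power_int_1_right zero_neq_one)

lemma recR: "norm z = 1 \<Longrightarrow>
    revR n z = rhoR (\<alpha> n) ** revR (Suc n) z + \<alpha> n ** zpL n z"
  using verblunsky mstar_eq[of z n] mstar_eq[of z "Suc n"]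
  unfolding verblunsky_coeffs_def zpL_def pL_def
  by (metis norm_zero power_int_1_right zero_neq_one)

lemma pL_perp_revR: "ip (pL (Suc n)) (revR n) = 0"
  by (rule perp_laurent[OF laurent_mono[OF revR_laurent] pL_perp pL_laurent]) auto

lemma zpL_perp_revR: "ip (revR (Suc n)) (zpL n) = 0"
  by (rule perp_laurent[OF zpL_laurent _ revR_laurent])
    (use revR_perp[of "Suc n"] in \<open>simp add: add.commute\<close>)

text \<open>Pairing a recursion with one of the two orthogonal functions on its right-hand side isolates
  the coefficient of that function.\<close>

lemma rhoL_eq: "rhoL (\<alpha> n) = ip (pL (Suc n)) (zpL n)"
  by (subst ip_comb[OF pL_laurent pL_laurent revR_laurent recL])
    (simp_all add: pL_orth pL_perp_revR)

lemma rhoR_eq: "rhoR (\<alpha> n) = ip (revR (Suc n)) (revR n)"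
  by (subst ip_comb[OF revR_laurent revR_laurent zpL_laurent recR])
    (simp_all add: revR_norm zpL_perp_revR)

text \<open>The definite description in \<open>msqrt\<close> says nothing about \<open>rhoL\<close> until a unique square root is
  known to exist. Instead \<open>rhoL_eq\<close> and \<open>triangular_orthogonality\<close> give
  \<open>\<rho>\<^sub>n\<^sup>L = \<kappa>\<^sub>n\<^sup>L (\<kappa>\<^bsub>n+1\<^esub>\<^sup>L)\<^bsup>-1\<^esup>\<close>, the inverse of a matrix that is positive definite by the
  normalization of the orthogonal polynomials.\<close>

lemma posdef_rhoL: "posdef (rhoL (\<alpha> n))"
proof (rule posdef_right_inverse)
  let ?\<kappa> = "\<lambda>n. coeff (\<phi>L n) n"
  show S: "posdef (?\<kappa> (Suc n) ** matrix_inv (?\<kappa> n))"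
    by (rule posdef_ratioL)
  have "rhoL (\<alpha> n) ** (?\<kappa> (Suc n) ** matrix_inv (?\<kappa> n)) = mat 1"
    using triL(3)[of n, folded zpL_def] leadL[of n]
    by (simp add: rhoL_eq matrix_mul_assoc matrix_inv_right)
  then show "(?\<kappa> (Suc n) ** matrix_inv (?\<kappa> n)) ** rhoL (\<alpha> n) = mat 1"
    by (simp add: matrix_left_right_inverse)
qed

text \<open>As for \<open>rhoL\<close>; the adjoints in \<open>adjR\<close> give \<open>\<rho>\<^sub>n\<^sup>R = (\<kappa>\<^sub>n\<^sup>R)\<^sup>\<dagger> ((\<kappa>\<^bsub>n+1\<^esub>\<^sup>R)\<^sup>\<dagger>)\<^bsup>-1\<^esup>\<close>, which is the
  inverse of the adjoint of the normalized ratio, and that ratio is its own adjoint.\<close>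

lemma posdef_rhoR: "posdef (rhoR (\<alpha> n))"
proof (rule posdef_right_inverse)
  let ?\<kappa> = "\<lambda>n. coeff (\<phi>R n) n"
  let ?S = "matrix_inv (?\<kappa> n) ** ?\<kappa> (Suc n)"
  show S: "posdef ?S"
    by (rule posdef_ratioR)
  have "rhoR (\<alpha> n) = ip (\<lambda>z. z powi int (Suc n) *\<^sub>C adjR (Suc n) z)
      (\<lambda>z. z powi int (Suc n) *\<^sub>C z powi - 1 *\<^sub>C adjR n z)"
    unfolding rhoR_eq by (rule ip_cong) (simp_all only: revR_def cscale_cscale powi_mult_circle, simp)
  also have "\<dots> = ip (adjR (Suc n)) (\<lambda>z. z powi - 1 *\<^sub>C adjR n z)"
    by (rule ip_shift)
  finally have "rhoR (\<alpha> n) ** (?\<kappa> (Suc n))\<^sup>\<dagger> = (?\<kappa> n)\<^sup>\<dagger>"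
    using triR(3)[of n] by simp
  moreover have "?S = (?\<kappa> (Suc n))\<^sup>\<dagger> ** (matrix_inv (?\<kappa> n))\<^sup>\<dagger>"
    using posdef_adj[OF S] by (simp add: cadj_mult)
  ultimately have "rhoR (\<alpha> n) ** ?S = (?\<kappa> n)\<^sup>\<dagger> ** (matrix_inv (?\<kappa> n))\<^sup>\<dagger>"
    by (simp add: matrix_mul_assoc)
  also have "\<dots> = mat 1"
    using leadR[of n] by (simp add: matrix_inv_left flip: cadj_mult)
  finally show "?S ** rhoR (\<alpha> n) = mat 1"
    by (simp add: matrix_left_right_inverse)
qed

lemma zpL_norm: "ip (zpL n) (zpL n) = mat 1"
  unfolding zpL_def ip_shift by (simp add: pL_orth)

text \<open>The squared norms of both sides of the recursion agree, and \<open>z \<phi>\<^sub>n\<^sup>L\<close> is normalized.\<close>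

lemma rhoL_square: "rhoL (\<alpha> n) ** rhoL (\<alpha> n) = mat 1 - (\<alpha> n)\<^sup>\<dagger> ** \<alpha> n"
  using gram_comb[OF pL_laurent revR_laurent recL, of n] posdef_adj[OF posdef_rhoL, of n]
  by (simp add: zpL_norm pL_orth revR_norm pL_perp_revR eq_diff_eq)

lemma rhoR_square: "rhoR (\<alpha> n) ** rhoR (\<alpha> n) = mat 1 - \<alpha> n ** (\<alpha> n)\<^sup>\<dagger>"
  using gram_comb[OF revR_laurent zpL_laurent recR, of n] posdef_adj[OF posdef_rhoR, of n]
  by (simp add: zpL_norm zpL_perp_revR revR_norm eq_diff_eq)

text \<open>The two recursions express \<open>z \<phi>\<^sub>n\<^sup>L\<close> by \<open>\<phi>\<^bsub>n+1\<^esub>\<^sup>L, (\<phi>\<^sub>n\<^sup>R)\<^sup>*\<close> and \<open>(\<phi>\<^sub>n\<^sup>R)\<^sup>*\<close> by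
  \<open>(\<phi>\<^bsub>n+1\<^esub>\<^sup>R)\<^sup>*, z \<phi>\<^sub>n\<^sup>L\<close>. Eliminating \<open>z \<phi>\<^sub>n\<^sup>L\<close> leaves
  \<open>(1 - \<alpha> \<alpha>\<^sup>\<dagger>) (\<phi>\<^sub>n\<^sup>R)\<^sup>* = \<rho>\<^sup>R (\<phi>\<^bsub>n+1\<^esub>\<^sup>R)\<^sup>* + \<alpha> \<rho>\<^sup>L \<phi>\<^bsub>n+1\<^esub>\<^sup>L\<close>. Since \<open>1 - \<alpha> \<alpha>\<^sup>\<dagger> = (\<rho>\<^sup>R)\<^sup>2\<close> and
  \<open>\<alpha> \<rho>\<^sup>L = \<rho>\<^sup>R \<alpha>\<close>, the invertible factor \<open>\<rho>\<^sup>R\<close> cancels. This produces the second row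
  \<open>(\<rho>\<^sup>R, - \<alpha>)\<close> of \<open>\<Theta>(\<alpha>)\<close>.\<close>

lemma inverse_recR:
  assumes z: "norm z = 1"
  shows "revR (Suc n) z = rhoR (\<alpha> n) ** revR n z + (- \<alpha> n) ** pL (Suc n) z"
proof -
  let ?Q = "rhoR (\<alpha> n)" and ?P = "rhoL (\<alpha> n)" and ?a = "\<alpha> n"
  have "revR n z = ?Q ** revR (Suc n) z + ?a ** (?P ** pL (Suc n) z + ?a\<^sup>\<dagger> ** revR n z)"
    using recR[OF z, of n] by (simp only: recL[OF z])
  also have "\<dots> = ?Q ** revR (Suc n) z + ?Q ** ?a ** pL (Suc n) z + ?a ** ?a\<^sup>\<dagger> ** revR n z"
    by (simp add: matrix_add_ldistrib matrix_mul_assoc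
        defect_intertwining[OF posdef_rhoL rhoL_square posdef_rhoR rhoR_square])
  finally have "?Q ** revR (Suc n) z + ?Q ** ?a ** pL (Suc n) z = (?Q ** ?Q) ** revR n z"
    by (simp add: rhoR_square matrix_diff_rdistrib algebra_simps)
  then have "?Q ** revR (Suc n) z = ?Q ** (?Q ** revR n z + (- ?a) ** pL (Suc n) z)"
    by (simp add: matrix_diff_ldistrib matrix_minus_left matrix_mul_assoc eq_diff_eq)
  then show ?thesis
    using posdef_invertible[OF posdef_rhoR[of n]]
    by (metis invertible_def matrix_mul_assoc matrix_mul_lid)
qed

section \<open>The CMV bases\<close>

text \<open>The CMV basis \<open>\<chi>\<close> and the alternate CMV basis \<open>x\<close> (here \<open>alt\<close>) on the circle, with the exponents
  for even and odd index written as one integer division: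
  for \<open>l = 2 m - 1\<close> one has \<open>l div 2 = m - 1\<close> and \<open>(l + 1) div 2 = m\<close>.\<close>

definition chi :: "nat \<Rightarrow> complex \<Rightarrow> 'k cmat"
  where "chi l z = z powi (- int (l div 2)) *\<^sub>C (if even l then revR l z else pL l z)"

definition alt :: "nat \<Rightarrow> complex \<Rightarrow> 'k cmat"
  where "alt l z = z powi (- int ((l + 1) div 2)) *\<^sub>C (if even l then pL l z else revR l z)"

lemma cmv_chi_eq: "norm z = 1 \<Longrightarrow> cmv_chi \<phi>L \<phi>R l z = chi l z"
  by (auto simp: cmv_chi_def chi_def mstar_eq pL_def elim!: oddE)

lemma cmv_x_eq: "norm z = 1 \<Longrightarrow> cmv_x \<phi>L \<phi>R l z = alt l z"
  by (auto simp: cmv_x_def alt_def mstar_eq pL_def elim!: evenE)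

lemma chi_laurent: "laurent {- int (l div 2)..int ((l + 1) div 2)} (chi l)"
  unfolding chi_def
  by (cases "even l") (auto intro!: laurent_shift[of "{0..int l}"] revR_laurent pL_laurent)

lemma alt_laurent: "laurent {- int ((l + 1) div 2)..int (l div 2)} (alt l)"
  unfolding alt_def
  by (cases "even l") (auto intro!: laurent_shift[of "{0..int l}"] revR_laurent pL_laurent)

text \<open>\<open>(\<phi>\<^sub>l\<^sup>R)\<^sup>*\<close> is orthogonal to \<open>z, \<dots>, z\<^sup>l\<close> and \<open>\<phi>\<^sub>l\<^sup>L\<close> to \<open>1, \<dots>, z\<^bsup>l-1\<^esup>\<close>. After the shift, \<open>chi l\<close>
  is therefore orthogonal to all exponents of its window except the one that the window
  gains over that of \<open>l - 1\<close>: the lowest for even \<open>l\<close>, the highest for odd \<open>l\<close>.\<close>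

lemma chi_orthonormal: "ip (chi j) (chi l) = (if j = l then mat 1 else 0)"
proof (rule orthonormal_by_windows[OF chi_laurent])
  fix j l :: nat assume "j < l"
  show "perp {- int (j div 2)..int ((j + 1) div 2)} (chi l)"
  proof (cases "even l")
    case True
    with \<open>j < l\<close> show ?thesis
      unfolding chi_def by (intro perp_shift[of "{1..int l}"]) (auto simp: revR_perp elim!: evenE)
  next
    case False
    with \<open>j < l\<close> show ?thesis
      unfolding chi_def by (intro perp_shift[of "{0..<int l}"]) (auto simp: pL_perp elim!: oddE)
  qed
next
  show "ip (chi l) (chi l) = mat 1" for l
    unfolding chi_def ip_shift by (cases "even l") (simp_all add: revR_norm pL_orth)
qed

text \<open>The windows now grow at the top for even \<open>l\<close> and at the bottom for odd \<open>l\<close>.\<close>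

lemma alt_orthonormal: "ip (alt j) (alt l) = (if j = l then mat 1 else 0)"
proof (rule orthonormal_by_windows[OF alt_laurent])
  fix j l :: nat assume "j < l"
  show "perp {- int ((j + 1) div 2)..int (j div 2)} (alt l)"
  proof (cases "even l")
    case False
    with \<open>j < l\<close> show ?thesis
      unfolding alt_def by (intro perp_shift[of "{1..int l}"]) (auto simp: revR_perp elim!: oddE)
  next
    case True
    with \<open>j < l\<close> show ?thesis
      unfolding alt_def by (intro perp_shift[of "{0..<int l}"]) (auto simp: pL_perp elim!: evenE)
  qed
next
  show "ip (alt l) (alt l) = mat 1" for l
    unfolding alt_def ip_shift by (cases "even l") (simp_all add: revR_norm pL_orth)
qed

lemma chi_0: "norm z = 1 \<Longrightarrow> chi 0 z = alt 0 z"
proof -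
  have "meval (\<phi>L 0) z = mat 1" "meval (\<phi>R 0) z = mat 1"
    by (simp_all add: ops_0 meval_def)
  then show ?thesis by (simp add: chi_def alt_def revR_def adjR_def pL_def)
qed

text \<open>For \<open>n = 2 m + 1\<close> the four functions here are \<open>z \<phi>\<^sub>n\<^sup>L, (\<phi>\<^bsub>n+1\<^esub>\<^sup>R)\<^sup>*, (\<phi>\<^sub>n\<^sup>R)\<^sup>*, \<phi>\<^bsub>n+1\<^esub>\<^sup>L\<close>,
  all multiplied by the same power \<open>z\<^bsup>-m-1\<^esup>\<close>.\<close>

lemma chi_in_alt:
  assumes z: "norm z = 1" and "odd n"
  shows "chi n z = (\<alpha> n)\<^sup>\<dagger> ** alt n z + rhoL (\<alpha> n) ** alt (Suc n) z"
    and "chi (Suc n) z = rhoR (\<alpha> n) ** alt n z + (- \<alpha> n) ** alt (Suc n) z"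
proof -
  from \<open>odd n\<close> obtain m where n: "n = 2 * m + 1" by (auto elim: oddE)
  have "chi n z = z powi (- int (Suc m)) *\<^sub>C zpL n z"
    unfolding zpL_def cscale_cscale powi_mult_circle[OF z] by (simp add: chi_def n)
  then show "chi n z = (\<alpha> n)\<^sup>\<dagger> ** alt n z + rhoL (\<alpha> n) ** alt (Suc n) z"
    by (simp only: recL[OF z]) (simp add: alt_def n cscale_add cscale_mult_right)
  show "chi (Suc n) z = rhoR (\<alpha> n) ** alt n z + (- \<alpha> n) ** alt (Suc n) z"
    using inverse_recR[OF z, of n]
    by (simp add: chi_def alt_def n cscale_add cscale_mult_right)
qed

text \<open>For \<open>n = 2 m\<close> the same four functions appear, multiplied by \<open>z\<^bsup>-m\<^esup>\<close>, with the roles of the two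
  bases exchanged.\<close>

lemma z_alt_in_chi:
  assumes z: "norm z = 1" and "even n"
  shows "z *\<^sub>C alt n z = (\<alpha> n)\<^sup>\<dagger> ** chi n z + rhoL (\<alpha> n) ** chi (Suc n) z"
    and "z *\<^sub>C alt (Suc n) z = rhoR (\<alpha> n) ** chi n z + (- \<alpha> n) ** chi (Suc n) z"
proof -
  from \<open>even n\<close> obtain m where n: "n = 2 * m" by (auto elim: evenE)
  have "z *\<^sub>C alt n z = z powi (- int m) *\<^sub>C zpL n z"
    by (simp add: alt_def zpL_def n mult.commute)
  then show "z *\<^sub>C alt n z = (\<alpha> n)\<^sup>\<dagger> ** chi n z + rhoL (\<alpha> n) ** chi (Suc n) z"
    by (simp only: recL[OF z]) (simp add: chi_def n cscale_add cscale_mult_right)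
  have "z *\<^sub>C alt (Suc n) z = (z powi 1 * z powi (- int (Suc m))) *\<^sub>C revR (Suc n) z"
    by (simp add: alt_def n)
  also have "\<dots> = z powi (- int m) *\<^sub>C revR (Suc n) z"
    unfolding powi_mult_circle[OF z] by simp
  finally show "z *\<^sub>C alt (Suc n) z = rhoR (\<alpha> n) ** chi n z + (- \<alpha> n) ** chi (Suc n) z"
    using inverse_recR[OF z, of n]
    by (simp add: chi_def n cscale_add cscale_mult_right)
qed

text \<open>Expansion coefficients in an orthonormal family are inner products. They stand on the left of
  the basis functions, so the two expansions fill the rows of \<open>\<Theta>\<close>.\<close>

lemma Theta_row:
  fixes e f :: "nat \<Rightarrow> complex \<Rightarrow> 'k cmat"
  assumes e: "\<And>l. laurent (W l) (e l)"
    and on: "\<And>j l. ip (e j) (e l) = (if j = l then mat 1 else 0)"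
    and f: "\<And>z. norm z = 1 \<Longrightarrow> f n z = \<beta>\<^sup>\<dagger> ** e n z + rhoL \<beta> ** e (Suc n) z"
      "\<And>z. norm z = 1 \<Longrightarrow> f (Suc n) z = rhoR \<beta> ** e n z + (- \<beta>) ** e (Suc n) z"
    and r: "r \<in> {n, Suc n}"
  shows "ip (e c) (f r) = (if c \<in> {n, Suc n} then Theta \<beta> (r - n) (c - n) else 0)"
  using r by (auto simp: ip_comb[OF e e e f(1)] ip_comb[OF e e e f(2)] on Theta_def)

lemma block_dsum_row:
  assumes n: "n = 2 * (r div 2)"
  shows "block_dsum B r c = (if c \<in> {n, Suc n} then B (r div 2) (r - n) (c - n) else 0)"
proof -
  have c: "r div 2 = c div 2 \<longleftrightarrow> c \<in> {n, Suc n}" unfolding n by auto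
  have r: "r mod 2 = r - n" unfolding n by (rule minus_mult_div_eq_mod[symmetric])
  have "c mod 2 = c - n" if "r div 2 = c div 2"
    unfolding n that by (rule minus_mult_div_eq_mod[symmetric])
  then show ?thesis unfolding block_dsum_def c r by simp
qed

lemma M_block:
  "row_action (cmv_M \<mu> A \<phi>L \<phi>R) = one_dsum (block_dsum (\<lambda>m. Theta (\<alpha> (2 * m + 1))))"
proof (intro ext)
  fix r c :: nat
  have eq: "row_action (cmv_M \<mu> A \<phi>L \<phi>R) r c = ip (alt c) (chi r)"
    unfolding row_action_def cmv_M_def by (rule ip_cong) (simp_all add: cmv_chi_eq cmv_x_eq)
  show "row_action (cmv_M \<mu> A \<phi>L \<phi>R) r c = one_dsum (block_dsum (\<lambda>m. Theta (\<alpha> (2 * m + 1)))) r c"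
  proof (cases r)
    case 0
    have "ip (alt c) (chi 0) = ip (alt c) (alt 0)" by (rule ip_cong) (simp_all add: chi_0)
    then show ?thesis by (simp add: eq[unfolded 0] 0 alt_orthonormal one_dsum_def)
  next
    case (Suc i)
    define n where "n = 2 * (i div 2)"
    have n: "i \<in> {n, Suc n}" "odd (Suc n)" unfolding n_def by auto
    have row: "ip (alt c) (chi r) =
        (if c \<in> {Suc n, Suc (Suc n)} then Theta (\<alpha> (Suc n)) (r - Suc n) (c - Suc n) else 0)"
      using n Suc by (intro Theta_row[OF alt_laurent alt_orthonormal chi_in_alt]) auto
    show ?thesis
    proof (cases c)
      case 0
      then show ?thesis unfolding eq row by (simp add: one_dsum_def Suc)
    next
      case (Suc j)
      have "one_dsum (block_dsum (\<lambda>m. Theta (\<alpha> (2 * m + 1)))) r c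
          = block_dsum (\<lambda>m. Theta (\<alpha> (2 * m + 1))) i j"
        by (simp add: one_dsum_def Suc \<open>r = Suc i\<close>)
      also have "\<dots> = (if j \<in> {n, Suc n} then Theta (\<alpha> (Suc n)) (i - n) (j - n) else 0)"
        by (simp add: block_dsum_row[OF n_def] flip: n_def)
      finally show ?thesis
        unfolding eq row by (simp add: Suc \<open>r = Suc i\<close>)
    qed
  qed
qed

lemma L_block: "row_action (cmv_L \<mu> A \<phi>L \<phi>R) = block_dsum (\<lambda>m. Theta (\<alpha> (2 * m)))"
proof (intro ext)
  fix r c :: nat
  define n where "n = 2 * (r div 2)"
  have n: "even n" "r \<in> {n, Suc n}" unfolding n_def by auto
  have "row_action (cmv_L \<mu> A \<phi>L \<phi>R) r c = ip (chi c) (\<lambda>z. z *\<^sub>C alt r z)"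
    unfolding row_action_def cmv_L_def by (rule ip_cong) (simp_all add: cmv_chi_eq cmv_x_eq)
  also have "\<dots> = (if c \<in> {n, Suc n} then Theta (\<alpha> n) (r - n) (c - n) else 0)"
    using n
    by (intro Theta_row[OF chi_laurent chi_orthonormal, of "\<lambda>r z. z *\<^sub>C alt r z"] z_alt_in_chi) auto
  also have "\<dots> = block_dsum (\<lambda>m. Theta (\<alpha> (2 * m))) r c"
    by (simp add: block_dsum_row[OF n_def] flip: n_def)
  finally show "row_action (cmv_L \<mu> A \<phi>L \<phi>R) r c = block_dsum (\<lambda>m. Theta (\<alpha> (2 * m))) r c" .
qed

end

theorem theorem4p2:
  fixes \<mu> :: "complex measure" and A :: "complex \<Rightarrow> 'k::finite cmat"
    and \<phi>L \<phi>R :: "nat \<Rightarrow> 'k cmat poly" and \<alpha> :: "nat \<Rightarrow> 'k cmat"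
  assumes "normalized_matrix_measure \<mu> A"
    and "nontrivial_matrix_measure \<mu> A"
    and "normalized_ops \<mu> A \<phi>L \<phi>R"
    and "verblunsky_coeffs \<phi>L \<phi>R \<alpha>"
  shows "row_action (cmv_M \<mu> A \<phi>L \<phi>R) = one_dsum (block_dsum (\<lambda>m. Theta (\<alpha> (2 * m + 1))))
       \<and> row_action (cmv_L \<mu> A \<phi>L \<phi>R) = block_dsum (\<lambda>m. Theta (\<alpha> (2 * m)))"
proof -
  interpret szego \<mu> A \<phi>L \<phi>R \<alpha>
    using assms by unfold_locales
  show ?thesis
    using M_block L_block by blast
qed

end
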